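(* Let $\mathscr{B}$ be a real Banach space, let $\mathscr{G}$ be a nonempty, bounded, closed and convex subset of $\mathscr{B}$, and let $\mu$ be an arbitrary measure of noncompactness in $\mathscr{B}$. Let $Q\in\mathcal{Q}$, $\delta\in\Delta$, $\mathscr{E}\in\mathbb{E}$, and let $F:\mathbb{R}_+\to\mathbb{R}_+$ be a non-decreasing continuous function. Let $\Psi:\mathscr{G}\to\mathscr{G}$ be a continuous mapping such that for every nonempty $\mathscr{K}\subset\mathscr{G}$, $$\mu(\Psi\mathscr{K})>0\implies Q\left\{\mathscr{E}\left(\mu(\Psi\mathscr{K}),F(\mu(\Psi\mathscr{K}))\right)\right\}\le \delta\left[Q\left\{\mathscr{E}\left(\mu(\mathscr{K}),F(\mu(\mathscr{K}))\right)\right\}\right].$$ Then $\Psi$ has at least one fixed point in $\mathscr{G}$.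
   Context: $\mathbb{R}_+=[0,\infty)$. For a Banach space $\mathscr{B}$, $\mathfrak{M}_{\mathscr{B}}$ denotes the collection of all nonempty bounded subsets of $\mathscr{B}$, $\mathfrak{N}_{\mathscr{B}}$ the collection of all relatively compact sets, $\bar{\mathscr{K}}$ the closure and $\mathrm{Conv}\,\mathscr{K}$ the convex closure (closed convex hull) of $\mathscr{K}$. A mapping $\mu:\mathfrak{M}_{\mathscr{B}}\to[0,\infty)$ is a measure of noncompactness in $\mathscr{B}$ if: (i) for all $\mathscr{K}\in\mathfrak{M}_{\mathscr{B}}$, $\mu(\mathscr{K})=0$ implies $\mathscr{K}$ is relatively compact; (ii) $\ker\mu=\{\mathscr{K}\in\mathfrak{M}_{\mathscr{B}}:\mu(\mathscr{K})=0\}\neq\emptyset$ and $\ker\mu\subset\mathfrak{N}_{\mathscr{B}}$; (iii) $\mathscr{K}\subseteq\mathscr{K}_1\implies\mu(\mathscr{K})\le\mu(\mathscr{K}_1)$; (iv) $\mu(\bar{\mathscr{K}})=\mu(\mathscr{K})$; (v) $\mu(\mathrm{Conv}\,\mathscr{K})=\mu(\mathscr{K})$; (vi) $\mu(\varpi\mathscr{K}+(1-\varpi)\mathscr{K}_1)\le\varpi\mu(\mathscr{K})+(1-\varpi)\mu(\mathscr{K}_1)$ for $\varpi\in[0,1)$; (vii) if $\mathscr{K}_q\in\mathfrak{M}_{\mathscr{B}}$, $\mathscr{K}_q=\bar{\mathscr{K}}_q$, $\mathscr{K}_{q+1}\subset\mathscr{K}_q$ for $q=1,2,\dots$ and $\lim_{q\to\infty}\mu(\mathscr{K}_q)=0$,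 then $\bigcap_{q=1}^\infty\mathscr{K}_q\neq\emptyset$. $\mathcal{Q}$ is the class of all $Q:\mathbb{R}_+\to\mathbb{R}$ such that: (a) $Q$ is non-decreasing; (b) $Q$ is continuous; (c) for each sequence $\{t_k\}\subset(0,\infty)$, $\lim_{k\to\infty}Q(t_k)=0\Leftrightarrow\lim_{k\to\infty}t_k=0$ (that is, $Q(t)=0$ iff $t=0$). $\Delta$ is the family of all functions $\delta:\mathbb{R}_+\to\mathbb{R}_+$ such that: (a) $\delta$ is monotone increasing; (b) $\lim_{q\to\infty}\delta^q(z)=0$ for all $z>0$, where $\delta^q$ is the $q$-fold iterate. $\mathbb{E}$ is the class of all $\mathscr{E}:\mathbb{R}_+\times\mathbb{R}_+\to\mathbb{R}$ such that: (a) $\mathscr{E}(z_1,z_2)\ge\max\{z_1,z_2\}$ for $z_1,z_2\ge0$; (b) $\mathscr{E}$ is continuous; (c) $\mathscr{E}(z_1+z_2,x_1+x_2)\le\mathscr{E}(z_1,x_1)+\mathscr{E}(z_2,x_2)$. *)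

theory Defs
  imports "HOL-Analysis.Analysis"
begin

text \<open>Functions that the source defines only on \<open>[0, \<infinity>)\<close>, on a subset of the space or on a family of
  sets are total here. Every condition on them is restricted to the intended domain, so the values
  outside that domain are irrelevant.\<close>

definition bounded_sets :: "'a::real_normed_vector set set" where
  "bounded_sets = {K. K \<noteq> {} \<and> bounded K}"

definition relatively_compact_sets :: "'a::real_normed_vector set set" where
  "relatively_compact_sets = {K. compact (closure K)}"

definition closed_convex_hull :: "'a::real_normed_vector set \<Rightarrow> 'a set" where
  "closed_convex_hull K = closure (convex hull K)"

definition mnc_kernel :: "('a::real_normed_vector set \<Rightarrow> real) \<Rightarrow> 'a set set" where
  "mnc_kernel \<mu> = {K \<in> bounded_sets. \<mu> K = 0}"

text \<open>Inclusion of sets is non-strict throughout, and the decreasing sequence in the last clause is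
  indexed from 0 instead of 1.\<close>

definition measure_of_noncompactness :: "('a::banach set \<Rightarrow> real) \<Rightarrow> bool" where
  "measure_of_noncompactness \<mu> \<longleftrightarrow>
     (\<forall>K \<in> bounded_sets. 0 \<le> \<mu> K) \<and>
     (\<forall>K \<in> bounded_sets. \<mu> K = 0 \<longrightarrow> K \<in> relatively_compact_sets) \<and>
     (mnc_kernel \<mu> \<noteq> {} \<and> mnc_kernel \<mu> \<subseteq> relatively_compact_sets) \<and>
     (\<forall>K \<in> bounded_sets. \<forall>K' \<in> bounded_sets. K \<subseteq> K' \<longrightarrow> \<mu> K \<le> \<mu> K') \<and>
     (\<forall>K \<in> bounded_sets. \<mu> (closure K) = \<mu> K) \<and>
     (\<forall>K \<in> bounded_sets. \<mu> (closed_convex_hull K) = \<mu> K) \<and>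
     (\<forall>K \<in> bounded_sets. \<forall>K' \<in> bounded_sets. \<forall>w \<in> {0..<1::real}.
        \<mu> {w *\<^sub>R x + (1 - w) *\<^sub>R y | x y. x \<in> K \<and> y \<in> K'} \<le> w * \<mu> K + (1 - w) * \<mu> K') \<and>
     (\<forall>K :: nat \<Rightarrow> 'a set.
        (\<forall>q. K q \<in> bounded_sets \<and> closure (K q) = K q \<and> K (Suc q) \<subseteq> K q) \<and>
        (\<lambda>q. \<mu> (K q)) \<longlonglongrightarrow> 0 \<longrightarrow> (\<Inter>q. K q) \<noteq> {})"

definition Q_class :: "(real \<Rightarrow> real) set" where
  "Q_class = {Q. mono_on {0..} Q \<and> continuous_on {0..} Q \<and>
     (\<forall>t :: nat \<Rightarrow> real. (\<forall>k. 0 < t k) \<longrightarrow> ((\<lambda>k. Q (t k)) \<longlonglongrightarrow> 0 \<longleftrightarrow> t \<longlonglongrightarrow> 0))}"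

text \<open>``Monotone increasing'' is read in the weak sense, which makes the class larger.\<close>

definition Delta_class :: "(real \<Rightarrow> real) set" where
  "Delta_class = {\<delta>. \<delta> ` {0..} \<subseteq> {0..} \<and> mono_on {0..} \<delta> \<and>
     (\<forall>z>0. (\<lambda>q. (\<delta> ^^ q) z) \<longlonglongrightarrow> 0)}"

definition E_class :: "(real \<times> real \<Rightarrow> real) set" where
  "E_class = {E. (\<forall>z1\<ge>0. \<forall>z2\<ge>0. max z1 z2 \<le> E (z1, z2)) \<and>
     continuous_on ({0..} \<times> {0..}) E \<and>
     (\<forall>z1\<ge>0. \<forall>z2\<ge>0. \<forall>x1\<ge>0. \<forall>x2\<ge>0. E (z1 + z2, x1 + x2) \<le> E (z1, x1) + E (z2, x2))}"

end

theory Submission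
  imports Defs
begin

text \<open>
  Iterating \<open>A \<mapsto> closed_convex_hull (\<Psi> ` A)\<close> from \<open>G\<close> gives a decreasing sequence of closed convex
  \<open>\<Psi>\<close>-invariant sets \<open>K n\<close>. If no \<open>\<mu> (K n)\<close> vanishes, the contractive condition bounds
  \<open>Q (E (\<mu> (K n), F (\<mu> (K n))))\<close> by the iterates of \<open>\<delta>\<close>, which forces \<open>\<mu> (K n)\<close> to tend to 0; so in
  every case there is a compact convex invariant set, to which Schauder's theorem applies. Schauder's
  theorem is reduced to Brouwer's by maps between the compact set and a cube given by a finite net.
\<close>

section \<open>Cubes in sequence space and Brouwer's theorem for them\<close>

text \<open>The dimension is a number rather than a type here, because Schauder's theorem
  needs cubes whose dimension is the size of an arbitrary finite net.\<close>

definition nat_cube :: "nat \<Rightarrow> (nat \<Rightarrow> real) set" where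
  "nat_cube n = {t. \<forall>i. t i \<in> (if i < n then {0..1} else {0})}"

lemma nat_cubeD:
  assumes "t \<in> nat_cube n"
  shows "0 \<le> t i" "t i \<le> 1" "n \<le> i \<Longrightarrow> t i = 0"
proof -
  have "t i \<in> (if i < n then {0..1} else {0})"
    using assms by (simp add: nat_cube_def)
  then show "0 \<le> t i" "t i \<le> 1" "n \<le> i \<Longrightarrow> t i = 0"
    by (auto split: if_splits)
qed

text \<open>Tychonoff's theorem: the cube is a product of compact intervals and singletons, and
  \<open>nat \<Rightarrow> real\<close> carries the product topology.\<close>

lemma compact_nat_cube: "compact (nat_cube n)"
proof -
  have "nat_cube n = PiE UNIV (\<lambda>i. if i < n then {0..1} else {0})"
    by (auto simp: nat_cube_def PiE_def Pi_def)
  moreover have "compactin (product_topology (\<lambda>i. euclidean) UNIV)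
      (PiE UNIV (\<lambda>i::nat. if i < n then {0..1::real} else {0}))"
    unfolding compactin_PiE by auto
  ultimately show ?thesis
    by (simp add: euclidean_product_topology)
qed

lemma tendsto_fun_coordinatewise_iff:
  fixes f :: "'a \<Rightarrow> 'i \<Rightarrow> 'b::topological_space"
  shows "(f \<longlongrightarrow> l) A \<longleftrightarrow> (\<forall>i. ((\<lambda>x. f x i) \<longlongrightarrow> l i) A)"
proof -
  have "(f \<longlongrightarrow> l) A \<longleftrightarrow> limitin (product_topology (\<lambda>i. euclidean) UNIV) f l A"
    by (simp add: euclidean_product_topology)
  then show ?thesis
    by (simp add: limitin_componentwise)
qed

text \<open>Kuhn's lemma on the grid of mesh \<open>1 / Suc k\<close> yields a cell in which each
  coordinate \<open>i < n\<close> of \<open>h x - x\<close> is nonnegative at some vertex and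
  nonpositive at another. By compactness a subsequence of the cells shrinks to a point, which is
  fixed by continuity.\<close>

lemma brouwer_nat_cube:
  assumes cont: "continuous_on (nat_cube n) h" and maps: "h ` nat_cube n \<subseteq> nat_cube n"
  shows "\<exists>t\<in>nat_cube n. h t = t"
proof -
  define sc :: "nat \<Rightarrow> (nat \<Rightarrow> nat) \<Rightarrow> nat \<Rightarrow> real"
    where "sc k x = (\<lambda>j. if j < n then real (x j) / real (Suc k) else 0)" for k x
  have sc_cube: "sc k x \<in> nat_cube n" if "\<forall>j<n. x j \<le> Suc k" for k x
    using that by (auto simp: sc_def nat_cube_def)
  have h_cube: "0 \<le> h t i" "h t i \<le> 1" "n \<le> i \<Longrightarrow> h t i = 0" if "t \<in> nat_cube n" for t i
    using that maps nat_cubeD[of "h t" n i] by auto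
  \<comment> \<open>Label 0 forces \<open>x \<le> h x\<close> and label 1 forces \<open>h x \<le> x\<close> in the coordinate at hand (on the
    face \<open>x = 1\<close> because \<open>h\<close> maps into the cube), so the vertices given by Kuhn's lemma squeeze \<open>h\<close>
    at their common limit.\<close>
  define label :: "nat \<Rightarrow> (nat \<Rightarrow> nat) \<Rightarrow> nat \<Rightarrow> nat"
    where "label k x i = (if x i \<noteq> Suc k \<and> sc k x i \<le> h (sc k x) i then 0 else 1)" for k x i
  \<comment> \<open>These are the vertices of the unit grid cell with lowest corner
    \<open>q\<close>. Coordinates from \<open>n\<close> on are left free because \<open>sc\<close>
    discards them.\<close>
  define near :: "(nat \<Rightarrow> nat) \<Rightarrow> (nat \<Rightarrow> nat) \<Rightarrow> bool"
    where "near q r \<longleftrightarrow> (\<forall>j<n. q j \<le> r j \<and> r j \<le> q j + 1)" for q r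
  have "\<exists>q. (\<forall>i<n. q i < Suc k) \<and> (\<forall>i<n. \<exists>r s. near q r \<and> near q s \<and>
      sc k r i \<le> h (sc k r) i \<and> h (sc k s) i \<le> sc k s i)" for k
  proof -
    obtain q where q: "\<forall>i<n. q i < Suc k"
      and rs: "\<forall>i<n. \<exists>r s. (\<forall>j<n. q j \<le> r j \<and> r j \<le> q j + 1) \<and>
        (\<forall>j<n. q j \<le> s j \<and> s j \<le> q j + 1) \<and> label k r i \<noteq> label k s i"
    proof (rule kuhn_lemma[of "Suc k" n "label k"])
      show "\<forall>x. (\<forall>i<n. x i \<le> Suc k) \<longrightarrow> (\<forall>i<n. x i = 0 \<longrightarrow> label k x i = 0)"
      proof (intro allI impI)
        fix x i assume "\<forall>i<n. x i \<le> Suc k" "i < n" "x i = 0"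
        then show "label k x i = 0"
          using h_cube(1)[OF sc_cube, of x k i] by (auto simp: label_def sc_def)
      qed
    qed (auto simp: label_def)
    have lab: "sc k r i \<le> h (sc k r) i \<and> h (sc k s) i \<le> sc k s i"
      if "near q r" "near q s" "label k r i = 0" "label k s i \<noteq> 0" "i < n" for r s i
    proof
      show "sc k r i \<le> h (sc k r) i"
        using that by (auto simp: label_def split: if_splits)
      have "\<forall>j<n. s j \<le> Suc k"
        using that(2) q unfolding near_def by fastforce
      then have "h (sc k s) i \<le> 1"
        by (intro h_cube sc_cube)
      then show "h (sc k s) i \<le> sc k s i"
        using that by (auto simp: label_def sc_def split: if_splits)
    qed
    have "\<exists>r s. near q r \<and> near q s \<and>
      sc k r i \<le> h (sc k r) i \<and> h (sc k s) i \<le> sc k s i" if i: "i < n" for i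
    proof -
      obtain r s where "near q r" "near q s" "label k r i \<noteq> label k s i"
        using rs i unfolding near_def by blast
      \<comment> \<open>Kuhn's lemma only makes the labels differ, so the roles of \<open>r\<close>
        and \<open>s\<close> may have to be swapped.\<close>
      moreover from this(3) have "label k r i = 0 \<and> label k s i \<noteq> 0 \<or> label k s i = 0 \<and> label k r i \<noteq> 0"
        by (auto simp: label_def split: if_splits)
      ultimately show ?thesis
        using lab[of r s i] lab[of s r i] i by metis
    qed
    with q show ?thesis by blast
  qed
  then obtain q where q: "\<And>k i. i < n \<Longrightarrow> q k i < Suc k"
    and "\<forall>k. \<forall>i<n. \<exists>r s. near (q k) r \<and> near (q k) s \<and>
      sc k r i \<le> h (sc k r) i \<and> h (sc k s) i \<le> sc k s i"
    by metis
  \<comment> \<open>The two vertices depend on the coordinate \<open>i\<close>; only the cell is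
    common to all coordinates.\<close>
  then obtain r s where near_r: "\<And>k i. i < n \<Longrightarrow> near (q k) (r k i)"
    and near_s: "\<And>k i. i < n \<Longrightarrow> near (q k) (s k i)"
    and r: "\<And>k i. i < n \<Longrightarrow> sc k (r k i) i \<le> h (sc k (r k i)) i"
    and s: "\<And>k i. i < n \<Longrightarrow> h (sc k (s k i)) i \<le> sc k (s k i) i"
    by metis
  have sc_q: "\<forall>k. sc k (q k) \<in> nat_cube n"
    using q by (auto intro!: sc_cube less_imp_le)
  obtain t \<phi> where t: "t \<in> nat_cube n" and \<phi>: "strict_mono \<phi>"
    and lim: "((\<lambda>k. sc k (q k)) \<circ> \<phi>) \<longlonglongrightarrow> t"
    by (rule seq_compactE[OF compact_imp_seq_compact[OF compact_nat_cube] sc_q])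
  \<comment> \<open>The cells shrink, so any choice of one vertex per cell has the same limit along
    \<open>\<phi>\<close> as the lowest corners. Hence vertices chosen for different coordinates all
    lead to \<open>t\<close>.\<close>
  have lim_near: "(\<lambda>k. h (sc (\<phi> k) (x (\<phi> k))) i) \<longlonglongrightarrow> h t i"
      "(\<lambda>k. sc (\<phi> k) (x (\<phi> k)) i) \<longlonglongrightarrow> t i"
    if x: "\<And>k. near (q k) (x k)" for x i
  proof -
    have coord: "(\<lambda>k. sc (\<phi> k) (x (\<phi> k)) j) \<longlonglongrightarrow> t j" for j
    proof -
      have "(\<lambda>k. sc k (x k) j - sc k (q k) j) \<longlonglongrightarrow> 0"
      proof (rule Lim_null_comparison)
        have "norm (sc k (x k) j - sc k (q k) j) \<le> inverse (real (Suc k))" for k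
        proof (cases "j < n")
          case True
          then have "real (q k j) \<le> real (x k j)" "real (x k j) \<le> real (q k j) + 1"
            using x[of k] unfolding near_def by force+
          then have "\<bar>real (x k j) - real (q k j)\<bar> / real (Suc k) \<le> 1 / real (Suc k)"
            by (intro divide_right_mono) auto
          moreover have "sc k (x k) j - sc k (q k) j = (real (x k j) - real (q k j)) / real (Suc k)"
            using True by (simp add: sc_def diff_divide_distrib)
          ultimately show ?thesis
            by (simp add: inverse_eq_divide)
        qed (simp add: sc_def)
        then show "\<forall>\<^sub>F k in sequentially.
            norm (sc k (x k) j - sc k (q k) j) \<le> inverse (real (Suc k))"
          by simp
      qed (rule LIMSEQ_inverse_real_of_nat)
      then have "(\<lambda>k. sc (\<phi> k) (x (\<phi> k)) j - sc (\<phi> k) (q (\<phi> k)) j) \<longlonglongrightarrow> 0"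
        using LIMSEQ_subseq_LIMSEQ[OF _ \<phi>] by (fastforce simp: o_def)
      moreover have "(\<lambda>k. sc (\<phi> k) (q (\<phi> k)) j) \<longlonglongrightarrow> t j"
        using lim by (simp add: tendsto_fun_coordinatewise_iff o_def)
      ultimately show ?thesis
        using tendsto_add by fastforce
    qed
    then show "(\<lambda>k. sc (\<phi> k) (x (\<phi> k)) i) \<longlonglongrightarrow> t i"
      by blast
    show "(\<lambda>k. h (sc (\<phi> k) (x (\<phi> k))) i) \<longlonglongrightarrow> h t i"
    proof -
      have "(\<lambda>k. sc (\<phi> k) (x (\<phi> k))) \<longlonglongrightarrow> t"
        using coord by (simp add: tendsto_fun_coordinatewise_iff)
      moreover have "sc k (x k) \<in> nat_cube n" for k
      proof (rule sc_cube, intro allI impI)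
        fix j assume "j < n"
        then show "x k j \<le> Suc k"
          using x[of k] q[of j k] by (force simp: near_def)
      qed
      ultimately have "(\<lambda>k. h (sc (\<phi> k) (x (\<phi> k)))) \<longlonglongrightarrow> h t"
        by (intro continuous_on_tendsto_compose[OF cont _ t] always_eventually allI)
      then show "(\<lambda>k. h (sc (\<phi> k) (x (\<phi> k))) i) \<longlonglongrightarrow> h t i"
        by (simp add: tendsto_fun_coordinatewise_iff)
    qed
  qed
  have "h t i = t i" for i
  proof (cases "i < n")
    case True
    show ?thesis
    proof (rule antisym)
      show "h t i \<le> t i"
        using s[OF True] by (intro LIMSEQ_le[OF lim_near[of "\<lambda>k. s k i"]] near_s True) auto
      show "t i \<le> h t i"
        using r[OF True] by (intro LIMSEQ_le[OF lim_near(2,1)[of "\<lambda>k. r k i"]] near_r True) auto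
    qed
  next
    case False
    then show ?thesis
      using h_cube(3)[OF t, of i] nat_cubeD(3)[OF t, of i] by simp
  qed
  with t show ?thesis by blast
qed

section \<open>Schauder's theorem for compact convex sets\<close>

text \<open>A finite \<open>e\<close>-net gives continuous maps \<open>\<phi>\<close> from
  \<open>C\<close> to a cube and \<open>m\<close> back to \<open>C\<close> such that
  \<open>m (\<phi> x)\<close> is within \<open>e\<close> of \<open>x\<close>. A Brouwer fixed point
  \<open>t\<close> of the map sending \<open>t\<close> to \<open>\<phi> (f (m t))\<close> then gives
  \<open>y = m t\<close>, since \<open>m (\<phi> (f y)) = y\<close>.\<close>

lemma schauder_approximate:
  fixes C :: "'a::real_normed_vector set"
  assumes C: "compact C" "convex C" "C \<noteq> {}"
    and f: "continuous_on C f" "f ` C \<subseteq> C" and e: "0 < e"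
  shows "\<exists>y\<in>C. dist (f y) y \<le> e"
proof -
  obtain N where N: "finite N" "N \<subseteq> C" "C \<subseteq> (\<Union>x\<in>N. ball x e)"
    using compactE_image[OF C(1), of C "\<lambda>x. ball x e"] e by (metis UN_I centre_in_ball open_ball subsetI)
  obtain b and n :: nat where b: "b ` {..<n} = N"
    using N(1) finite_imp_nat_seg_image_inj_on[of N] by (metis lessThan_def)
  \<comment> \<open>Tent functions, positive exactly on the open \<open>e\<close>-balls around the
    net points; \<open>\<phi>\<close> normalises them to a partition of unity on
    \<open>C\<close>.\<close>
  define w where "w i x = max 0 (e - dist x (b i))" for i x
  define W where "W x = (\<Sum>i<n. w i x)" for x
  define \<phi> where "\<phi> x i = (if i < n then w i x / W x else 0)" for x i
  define S :: "(nat \<Rightarrow> real) \<Rightarrow> real" where "S t = (\<Sum>i<n. t i)" for t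
  \<comment> \<open>Normalising by \<open>S t\<close> would fail at \<open>t = 0\<close>. Since
    \<open>M t\<close> is at least 1, dividing by it is safe; the deficit \<open>M t - S t\<close>,
    nonzero only if \<open>S t < 1\<close>, is assigned to \<open>b 0\<close>.\<close>
  define M where "M t = max 1 (S t)" for t
  \<comment> \<open>Weights with sum 1 on the whole cube; they agree with \<open>t\<close> itself when \<open>S t = 1\<close>.\<close>
  define u where "u t i = (t i + (if i = 0 then M t - S t else 0)) / M t" for t i
  define m where "m t = (\<Sum>i<n. u t i *\<^sub>R b i)" for t
  have bC: "b i \<in> C" if "i < n" for i
    using b N(2) that by blast
  \<comment> \<open>The index 0 that receives the deficit must be an index of the net.\<close>
  have n: "0 < n"
    using N(3) C(3) b by (cases n) auto
  have w_nonneg: "0 \<le> w i x" for i x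
    by (simp add: w_def)
  have W_pos: "0 < W x" if x: "x \<in> C" for x
  proof -
    obtain i where "i < n" "dist x (b i) < e"
      using N(3) x b by (force simp: dist_commute)
    then show ?thesis
      unfolding W_def using w_nonneg by (intro sum_pos2[of _ i]) (auto simp: w_def)
  qed
  have \<phi>_sum: "(\<Sum>i<n. \<phi> x i) = 1" if "x \<in> C" for x
    using W_pos[OF that] by (simp add: \<phi>_def W_def flip: sum_divide_distrib)
  have \<phi>_nonneg: "0 \<le> \<phi> x i" if "x \<in> C" for x i
    using W_pos[OF that] w_nonneg by (simp add: \<phi>_def)
  have \<phi>_cube: "\<phi> x \<in> nat_cube n" if x: "x \<in> C" for x
  proof -
    have "\<phi> x i \<le> 1" if "i < n" for i
      using member_le_sum[of i "{..<n}" "\<phi> x"] \<phi>_nonneg[OF x] \<phi>_sum[OF x] that by simp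
    then show ?thesis
      using \<phi>_nonneg[OF x] by (auto simp: nat_cube_def) (simp add: \<phi>_def)
  qed
  have cont_\<phi>: "continuous_on C \<phi>"
  proof (rule continuous_on_coordinatewise_then_product)
    show "continuous_on C (\<lambda>x. \<phi> x i)" for i
    proof (cases "i < n")
      case True
      have "continuous_on C (\<lambda>x. w i x / W x)"
        unfolding w_def W_def
        by (intro continuous_intros) (use W_pos in \<open>force simp: w_def W_def\<close>)
      then show ?thesis using True by (simp add: \<phi>_def)
    qed (simp add: \<phi>_def)
  qed
  have m_mem: "m t \<in> C" if t: "t \<in> nat_cube n" for t
    unfolding m_def
  proof (rule convex_sum)
    have M: "1 \<le> M t" "S t \<le> M t" by (auto simp: M_def)
    have "(\<Sum>i<n. u t i) = (S t + (M t - S t)) / M t"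
      using n by (simp add: u_def S_def sum.distrib flip: sum_divide_distrib)
    then show "(\<Sum>i<n. u t i) = 1"
      using M by simp
    show "0 \<le> u t i" if "i \<in> {..<n}" for i
      using nat_cubeD(1)[OF t, of i] M by (auto simp: u_def)
  qed (use C bC in auto)
  have cont_m: "continuous_on (nat_cube n) m"
  proof -
    have "continuous_on (nat_cube n) (\<lambda>t. t i)" for i
      by (rule continuous_on_subset[OF continuous_on_product_coordinates]) simp
    then have S: "continuous_on (nat_cube n) S" and t: "continuous_on (nat_cube n) (\<lambda>t. t i)" for i
      unfolding S_def by (auto intro!: continuous_intros)
    then have M: "continuous_on (nat_cube n) M"
      unfolding M_def by (intro continuous_intros)
    have "M t \<noteq> 0" for t
      by (simp add: M_def)
    then have "continuous_on (nat_cube n) (\<lambda>t. u t i)" for i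
      unfolding u_def by (cases "i = 0") (simp_all add: continuous_intros S M t)
    then show ?thesis
      unfolding m_def by (intro continuous_intros)
  qed
  have m_\<phi>: "dist x (m (\<phi> x)) \<le> e" if x: "x \<in> C" for x
  proof -
    have "S (\<phi> x) = 1"
      using \<phi>_sum[OF x] by (simp add: S_def)
    then have "u (\<phi> x) i = \<phi> x i" for i
      by (simp add: u_def M_def)
    then have "x - m (\<phi> x) = (\<Sum>i<n. \<phi> x i *\<^sub>R (x - b i))"
      using \<phi>_sum[OF x] by (simp add: m_def scaleR_diff_right sum_subtractf flip: scaleR_left.sum)
    also have "norm \<dots> \<le> (\<Sum>i<n. \<phi> x i * e)"
    proof (rule sum_norm_le)
      fix i
      \<comment> \<open>Net points farther than \<open>e\<close> from \<open>x\<close> get weight 0,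
        so \<open>x - m (\<phi> x)\<close> is a convex combination of vectors of norm at most
        \<open>e\<close>, up to zero terms.\<close>
      have "\<phi> x i = 0 \<or> norm (x - b i) \<le> e"
        by (cases "norm (x - b i) \<le> e") (simp_all add: \<phi>_def w_def dist_norm)
      then show "norm (\<phi> x i *\<^sub>R (x - b i)) \<le> \<phi> x i * e"
        using \<phi>_nonneg[OF x, of i] by (elim disjE) (simp, simp add: mult_left_mono)
    qed
    also have "\<dots> = e"
      using \<phi>_sum[OF x] by (simp flip: sum_distrib_right)
    finally show ?thesis
      by (simp add: dist_norm)
  qed
  have "continuous_on (nat_cube n) (\<lambda>t. \<phi> (f (m t)))"
    by (rule continuous_on_compose2[OF cont_\<phi> continuous_on_compose2[OF f(1) cont_m]])
      (use m_mem f(2) in auto)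
  moreover have "(\<lambda>t. \<phi> (f (m t))) ` nat_cube n \<subseteq> nat_cube n"
    using m_mem f(2) \<phi>_cube by blast
  ultimately obtain t where t: "t \<in> nat_cube n" "\<phi> (f (m t)) = t"
    using brouwer_nat_cube by blast
  then have "dist (f (m t)) (m t) \<le> e"
    using m_\<phi>[of "f (m t)"] m_mem f(2) by auto
  then show ?thesis
    using m_mem t(1) by blast
qed

text \<open>The displacement \<open>dist (f x) x\<close> attains its minimum on \<open>C\<close>; a
  positive minimum would be undercut by an approximate fixed point at half its value.\<close>

theorem schauder_compact:
  fixes C :: "'a::real_normed_vector set"
  assumes C: "compact C" "convex C" "C \<noteq> {}"
    and f: "continuous_on C f" "f ` C \<subseteq> C"
  shows "\<exists>x\<in>C. f x = x"
proof -
  have "continuous_on C (\<lambda>x. dist (f x) x)"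
    by (intro continuous_intros f)
  then obtain x where x: "x \<in> C" "\<And>y. y \<in> C \<Longrightarrow> dist (f x) x \<le> dist (f y) y"
    using continuous_attains_inf[OF C(1,3)] by blast
  have "f x = x"
  proof (rule ccontr)
    assume "f x \<noteq> x"
    then obtain y where "y \<in> C" "dist (f y) y \<le> dist (f x) x / 2"
      using schauder_approximate[OF C f, of "dist (f x) x / 2"] by auto
    then show False
      using x(2)[of y] zero_less_dist_iff[of "f x" x] \<open>f x \<noteq> x\<close> by linarith
  qed
  with x(1) show ?thesis by blast
qed

section \<open>Consequences of the axioms for \<open>\<mu>\<close>, \<open>Q\<close> and
  \<open>\<delta>\<close>\<close>

lemma measure_of_noncompactnessD:
  assumes "measure_of_noncompactness \<mu>"
  shows "K \<in> bounded_sets \<Longrightarrow> 0 \<le> \<mu> K"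
    and "K \<in> bounded_sets \<Longrightarrow> \<mu> K = 0 \<Longrightarrow> compact (closure K)"
    and "K \<in> bounded_sets \<Longrightarrow> K' \<in> bounded_sets \<Longrightarrow> K \<subseteq> K' \<Longrightarrow> \<mu> K \<le> \<mu> K'"
    and "K \<in> bounded_sets \<Longrightarrow> \<mu> (closed_convex_hull K) = \<mu> K"
    and "(\<And>q. A q \<in> bounded_sets) \<Longrightarrow> (\<And>q. closed (A q)) \<Longrightarrow> (\<And>q. A (Suc q) \<subseteq> A q) \<Longrightarrow>
      (\<lambda>q. \<mu> (A q)) \<longlonglongrightarrow> 0 \<Longrightarrow> (\<Inter>q. A q) \<noteq> {}"
proof -
  note mnc = assms[unfolded measure_of_noncompactness_def]
  show "K \<in> bounded_sets \<Longrightarrow> 0 \<le> \<mu> K"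
    using mnc[THEN conjunct1] by simp
  show "K \<in> bounded_sets \<Longrightarrow> \<mu> K = 0 \<Longrightarrow> compact (closure K)"
    using mnc[THEN conjunct2, THEN conjunct1] by (simp add: relatively_compact_sets_def)
  show "K \<in> bounded_sets \<Longrightarrow> K' \<in> bounded_sets \<Longrightarrow> K \<subseteq> K' \<Longrightarrow> \<mu> K \<le> \<mu> K'"
    using mnc[THEN conjunct2, THEN conjunct2, THEN conjunct2, THEN conjunct1] by simp
  note mnc' = mnc[THEN conjunct2, THEN conjunct2, THEN conjunct2, THEN conjunct2, THEN conjunct2]
  show "K \<in> bounded_sets \<Longrightarrow> \<mu> (closed_convex_hull K) = \<mu> K"
    using mnc'[THEN conjunct1] by simp
  show "(\<And>q. A q \<in> bounded_sets) \<Longrightarrow> (\<And>q. closed (A q)) \<Longrightarrow> (\<And>q. A (Suc q) \<subseteq> A q) \<Longrightarrow>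
      (\<lambda>q. \<mu> (A q)) \<longlonglongrightarrow> 0 \<Longrightarrow> (\<Inter>q. A q) \<noteq> {}"
    using mnc'[THEN conjunct2, THEN conjunct2, THEN spec, of A] by (simp add: closure_closed)
qed

text \<open>Along \<open>t / Suc k\<close> the values of \<open>Q\<close> tend to 0 and by
  monotonicity stay below \<open>Q t\<close>, so \<open>Q t\<close> is nonnegative; the constant
  sequence \<open>t\<close> rules out \<open>Q t = 0\<close>.\<close>

lemma Q_class_pos:
  assumes "Q \<in> Q_class" "0 < t"
  shows "0 < Q t"
proof -
  have mono: "mono_on {0..} Q"
    and lim: "\<And>t :: nat \<Rightarrow> real. (\<forall>k. 0 < t k) \<Longrightarrow> (\<lambda>k. Q (t k)) \<longlonglongrightarrow> 0 \<longleftrightarrow> t \<longlonglongrightarrow> 0"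
    using assms(1) by (auto simp: Q_class_def)
  define s where "s k = t / real (Suc k)" for k
  have s: "0 < s k" "s k \<le> t" for k
    using assms(2) by (auto simp: s_def field_simps)
  have "s \<longlonglongrightarrow> 0"
    unfolding s_def using LIMSEQ_Suc[OF lim_const_over_n[of t]] .
  then have "(\<lambda>k. Q (s k)) \<longlonglongrightarrow> 0"
    using lim s(1) by blast
  moreover have "Q (s k) \<le> Q t" for k
    using s[of k] assms(2) by (intro mono_onD[OF mono]) auto
  ultimately have "0 \<le> Q t"
    by (intro LIMSEQ_le_const2) auto
  moreover have "Q t \<noteq> 0"
    using lim[of "\<lambda>_. t"] assms(2) by (auto simp: LIMSEQ_const_iff)
  ultimately show ?thesis by simp
qed

text \<open>Induction by monotonicity of \<open>\<delta>\<close>, which holds on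
  \<open>{0..}\<close> only; hence the assumption that \<open>w\<close> is nonnegative.\<close>

lemma Delta_class_iterates_bound:
  assumes \<delta>: "\<delta> \<in> Delta_class" and w: "\<And>n. 0 \<le> w n" "\<And>n. w (Suc n) \<le> \<delta> (w n)"
  shows "w n \<le> (\<delta> ^^ n) (w 0)"
proof (induction n)
  case (Suc n)
  have "\<delta> (w n) \<le> \<delta> ((\<delta> ^^ n) (w 0))"
    using \<delta> Suc w(1)[of n] unfolding Delta_class_def
    by (intro mono_onD[of "{0..}" \<delta>]) auto
  then show ?case
    using w(2)[of n] by simp
qed simp

section \<open>Decreasing invariant hulls under the contractive condition\<close>

theorem theorem2p1:
  fixes G :: "'a::banach set"
    and \<mu> :: "'a set \<Rightarrow> real"
    and Q \<delta> F :: "real \<Rightarrow> real"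
    and E :: "real \<times> real \<Rightarrow> real"
    and \<Psi> :: "'a \<Rightarrow> 'a"
  assumes "G \<noteq> {}" and "bounded G" and "closed G" and "convex G"
    and "measure_of_noncompactness \<mu>"
    and "Q \<in> Q_class" and "\<delta> \<in> Delta_class" and "E \<in> E_class"
    and "F ` {0..} \<subseteq> {0..}" and "mono_on {0..} F" and "continuous_on {0..} F"
    and "\<Psi> ` G \<subseteq> G" and "continuous_on G \<Psi>"
    and "\<And>K. K \<noteq> {} \<Longrightarrow> K \<subseteq> G \<Longrightarrow> \<mu> (\<Psi> ` K) > 0 \<Longrightarrow>
           Q (E (\<mu> (\<Psi> ` K), F (\<mu> (\<Psi> ` K)))) \<le> \<delta> (Q (E (\<mu> K, F (\<mu> K))))"
  shows "\<exists>x\<in>G. \<Psi> x = x"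
proof -
  note mnc = measure_of_noncompactnessD[OF assms(5)]
  have bdd: "A \<in> bounded_sets" if "A \<noteq> {}" "A \<subseteq> G" for A
    using that assms(2) by (auto simp: bounded_sets_def intro: bounded_subset)
  have compact_if: "compact A" if "A \<noteq> {}" "A \<subseteq> G" "closed A" "\<mu> A = 0" for A
    using mnc(2)[OF bdd[OF that(1,2)] that(4)] that(3) by (simp add: closure_closed)
  have hull_sub: "closed_convex_hull A \<subseteq> B" if "A \<subseteq> B" "closed B" "convex B" for A B :: "'a set"
    using that by (simp add: closed_convex_hull_def closure_minimal hull_minimal)
  have sub_hull: "A \<subseteq> closed_convex_hull A" for A :: "'a set"
    unfolding closed_convex_hull_def by (meson closure_subset hull_subset order_trans)
  define K where "K = rec_nat G (\<lambda>_ A. closed_convex_hull (\<Psi> ` A))"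
  have K_0: "K 0 = G" and K_Suc: "K (Suc n) = closed_convex_hull (\<Psi> ` K n)" for n
    by (simp_all add: K_def)
  have K_closed: "closed (K n)" and K_convex: "convex (K n)" for n
    using assms(3,4)
    by (cases n; simp add: K_0 K_Suc closed_convex_hull_def convex_closure convex_convex_hull)+
  have K_dec: "K (Suc n) \<subseteq> K n" for n
  proof (induction n)
    case 0
    then show ?case
      using hull_sub[OF assms(12,3,4)] by (simp add: K_0 K_Suc)
  next
    case (Suc n)
    then have "\<Psi> ` K (Suc n) \<subseteq> K (Suc n)"
      using sub_hull[of "\<Psi> ` K n"] by (auto simp: K_Suc[of n])
    then show ?case
      unfolding K_Suc[of "Suc n"] by (rule hull_sub) (rule K_closed K_convex)+
  qed
  have K_sub: "K n \<subseteq> G" for n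
    using K_dec by (induction n) (auto simp: K_0)
  have K_ne: "K n \<noteq> {}" for n
    using assms(1) sub_hull by (induction n) (auto simp: K_0 K_Suc, blast)
  have K_inv: "\<Psi> ` K n \<subseteq> K n" for n
    using sub_hull[of "\<Psi> ` K n"] K_dec[of n] by (simp add: K_Suc)
  have K_bdd: "K n \<in> bounded_sets" for n
    by (intro bdd K_ne K_sub)
  have \<mu>_K_Suc: "\<mu> (K (Suc n)) = \<mu> (\<Psi> ` K n)" for n
    unfolding K_Suc using K_ne K_inv K_sub by (intro mnc(4) bdd) blast+
  have fixed: "\<exists>x\<in>G. \<Psi> x = x"
    if "A \<noteq> {}" "A \<subseteq> G" "closed A" "convex A" "\<Psi> ` A \<subseteq> A" "\<mu> A = 0" for A
    using schauder_compact[OF compact_if[OF that(1,2,3,6)] that(4,1) continuous_on_subset[OF assms(13) that(2)] that(5)]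
      that(2) by blast
  show ?thesis
  proof (cases "\<exists>n. \<mu> (K n) = 0")
    case True
    then obtain n where "\<mu> (K n) = 0" by blast
    then show ?thesis
      by (rule fixed[OF K_ne K_sub K_closed K_convex K_inv])
  next
    case False
    \<comment> \<open>Positivity makes the contractive condition available at every stage and lets
      the sequential condition on \<open>Q\<close> apply, which concerns positive sequences.\<close>
    then have a_pos: "0 < \<mu> (K n)" for n
      using mnc(1)[OF K_bdd[of n]] by (metis order_le_less)
    define v where "v n = E (\<mu> (K n), F (\<mu> (K n)))" for n
    \<comment> \<open>\<open>E\<close> dominates the maximum of its arguments, so driving
      \<open>v\<close> to 0 drives \<open>\<mu> (K n)\<close> to 0.\<close>
    have a_le_v: "\<mu> (K n) \<le> v n" for n
    proof -
      have "0 \<le> F (\<mu> (K n))"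
        using assms(9) a_pos[of n] by (simp add: image_subset_iff less_imp_le)
      then show ?thesis
        using assms(8) a_pos[of n] by (simp add: E_class_def v_def less_imp_le)
    qed
    then have v_pos: "0 < v n" for n
      using a_pos[of n] by (meson less_le_trans)
    then have Qv_pos: "0 < Q (v n)" for n
      by (rule Q_class_pos[OF assms(6)])
    have step: "Q (v (Suc n)) \<le> \<delta> (Q (v n))" for n
      using assms(14)[OF K_ne K_sub, of n] a_pos[of "Suc n"] by (simp add: v_def \<mu>_K_Suc)
    have "(\<lambda>n. Q (v n)) \<longlonglongrightarrow> 0"
    proof (rule tendsto_sandwich[OF _ _ tendsto_const])
      show "(\<lambda>n. (\<delta> ^^ n) (Q (v 0))) \<longlonglongrightarrow> 0"
        using assms(7) Qv_pos[of 0] by (simp add: Delta_class_def)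
      show "\<forall>\<^sub>F n in sequentially. Q (v n) \<le> (\<delta> ^^ n) (Q (v 0))"
        using Delta_class_iterates_bound[OF assms(7), of "\<lambda>n. Q (v n)"] Qv_pos step
        by (simp add: less_imp_le)
    qed (use Qv_pos in \<open>simp add: less_imp_le\<close>)
    then have "v \<longlonglongrightarrow> 0"
      using assms(6) v_pos by (simp add: Q_class_def)
    then have lim: "(\<lambda>n. \<mu> (K n)) \<longlonglongrightarrow> 0"
      by (rule tendsto_sandwich[OF _ _ tendsto_const, rotated 2])
        (use a_pos a_le_v in \<open>simp_all add: less_imp_le\<close>)
    define L where "L = (\<Inter>n. K n)"
    \<comment> \<open>This is the generalised Cantor intersection axiom for \<open>\<mu>\<close>;
      monotonicity then gives \<open>\<mu> L = 0\<close>, so the closed set \<open>L\<close> is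
      compact.\<close>
    have L_ne: "L \<noteq> {}"
      unfolding L_def by (intro mnc(5) K_bdd K_closed K_dec lim)
    have L_sub: "L \<subseteq> K n" for n
      by (auto simp: L_def)
    have L_G: "L \<subseteq> G"
      using L_sub[of 0] by (simp add: K_0)
    have "\<mu> L \<le> \<mu> (K n)" for n
      by (intro mnc(3) bdd L_ne L_G K_bdd L_sub)
    then have "\<mu> L \<le> 0"
      using lim by (intro LIMSEQ_le_const) auto
    then have "\<mu> L = 0"
      using mnc(1)[OF bdd[OF L_ne L_G]] by simp
    moreover have "closed L" "convex L"
      unfolding L_def by (simp_all add: closed_INT convex_INT K_closed K_convex)
    moreover have "\<Psi> ` L \<subseteq> L"
      using K_inv by (fastforce simp: L_def)
    ultimately show ?thesis
      using fixed L_ne L_G by blast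
  qed
qed

end
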